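(* Let $R$ be a pseudo-valuation domain (PVD). Then: (1) $R$ is Clifford $t$-regular. (2) $R$ is Boole $t$-regular if and only if its associated valuation overring is Boole regular.
   Context: All rings are integral domains. Let $R$ be a domain with quotient field $K$. For fractional ideals $I,J$ of $R$, $(I:J)=\{x\in K : xJ\subseteq I\}$. For a nonzero fractional ideal $I$, put $I^{-1}=(R:I)$, $I_v=(I^{-1})^{-1}$, and $I_t=\bigcup J_v$, where $J$ ranges over the nonzero finitely generated fractional ideals contained in $I$. $I$ is a $t$-ideal if it is nonzero and $I_t=I$. The fractional $t$-ideals form a commutative semigroup $F_t(R)$ under $(I,J)\mapsto (IJ)_t$, and $\mathcal S_t(R)=F_t(R)/P(R)$ is the quotient by the group $P(R)$ of nonzero principal fractional ideals (so the classes of $I$ and $J$ coincide iff $I=cJ$ for some $0\neq c\in K$). Likewise $\mathcal S(R)=F(R)/P(R)$, where $F(R)$ is the semigroup of all nonzero fractional ideals under ordinary multiplication. A commutative semigroup $S$ is Clifford if for every $x\in S$ there is $a\in S$ with $x^2a=x$, and Boolean if $x^2=x$ for every $x\in S$. $R$ is Clifford (resp., Boole) $t$-regular if $\mathcal S_t(R)$ is Clifford (resp., Boolean); $R$ is Boole regular if $\mathcal S(R)$ is Boolean. A domain $R$ with quotient field $K$ is a pseudo-valuation domain (PVD) if for every prime ideal $P$ of $R$ and all $x,y\in K$, $xy\in P$ implies $x\in P$ or $y\in P$; equivalently, $R$ is local and there is a (unique) valuation overring $V$ of $R$ having the same maximal ideal as $R$; this $V$ is the associated valuation overring of $R$. 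*)

theory Defs
  imports Main "HOL.Hull"
begin

text \<open>
  The quotient field \<open>K\<close> is the whole type \<open>'k::field\<close>; a domain with quotient field \<open>K\<close> is a
  subring of \<open>K\<close> whose quotients exhaust \<open>K\<close>. Overrings are then subsets of the same type.
\<close>

definition subring_of_field :: "'k::field set \<Rightarrow> bool" where
  "subring_of_field R \<longleftrightarrow>
     1 \<in> R \<and> (\<forall>x\<in>R. \<forall>y\<in>R. x - y \<in> R) \<and> (\<forall>x\<in>R. \<forall>y\<in>R. x * y \<in> R)"

definition domain_with_quotient_field :: "'k::field set \<Rightarrow> bool" where
  "domain_with_quotient_field R \<longleftrightarrow>
     subring_of_field R \<and> (\<forall>x. \<exists>a\<in>R. \<exists>b\<in>R. b \<noteq> 0 \<and> x = a / b)"

definition submodule_of_field :: "'k::field set \<Rightarrow> 'k set \<Rightarrow> bool" where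
  "submodule_of_field R I \<longleftrightarrow>
     0 \<in> I \<and> (\<forall>x\<in>I. \<forall>y\<in>I. x + y \<in> I) \<and> (\<forall>r\<in>R. \<forall>x\<in>I. r * x \<in> I)"

definition ideal_of :: "'k::field set \<Rightarrow> 'k set \<Rightarrow> bool" where
  "ideal_of R I \<longleftrightarrow> submodule_of_field R I \<and> I \<subseteq> R"

definition prime_ideal_of :: "'k::field set \<Rightarrow> 'k set \<Rightarrow> bool" where
  "prime_ideal_of R P \<longleftrightarrow>
     ideal_of R P \<and> P \<noteq> R \<and> (\<forall>a\<in>R. \<forall>b\<in>R. a * b \<in> P \<longrightarrow> a \<in> P \<or> b \<in> P)"

definition maximal_ideal_of :: "'k::field set \<Rightarrow> 'k set \<Rightarrow> bool" where
  "maximal_ideal_of R M \<longleftrightarrow>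
     ideal_of R M \<and> M \<noteq> R \<and> (\<forall>N. ideal_of R N \<and> M \<subseteq> N \<longrightarrow> N = M \<or> N = R)"


subsection \<open>Fractional ideals and the \<open>t\<close>-operation\<close>

definition fractional_ideal :: "'k::field set \<Rightarrow> 'k set \<Rightarrow> bool" where
  "fractional_ideal R I \<longleftrightarrow>
     submodule_of_field R I \<and> (\<exists>d\<in>R. d \<noteq> 0 \<and> (\<forall>x\<in>I. d * x \<in> R))"

definition nonzero_fractional_ideals :: "'k::field set \<Rightarrow> 'k set set" where
  "nonzero_fractional_ideals R = {I. fractional_ideal R I \<and> I \<noteq> {0}}"

definition finitely_generated :: "'k::field set \<Rightarrow> 'k set \<Rightarrow> bool" where
  "finitely_generated R I \<longleftrightarrow> (\<exists>S. finite S \<and> I = submodule_of_field R hull S)"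

definition ideal_mult :: "'k::field set \<Rightarrow> 'k set \<Rightarrow> 'k set \<Rightarrow> 'k set" where
  "ideal_mult R I J = submodule_of_field R hull {x * y |x y. x \<in> I \<and> y \<in> J}"

definition ideal_colon :: "'k::field set \<Rightarrow> 'k set \<Rightarrow> 'k set" where
  "ideal_colon I J = {x. \<forall>y\<in>J. x * y \<in> I}"

definition ideal_inverse :: "'k::field set \<Rightarrow> 'k set \<Rightarrow> 'k set" where
  "ideal_inverse R I = ideal_colon R I"

definition v_closure :: "'k::field set \<Rightarrow> 'k set \<Rightarrow> 'k set" where
  "v_closure R I = ideal_inverse R (ideal_inverse R I)"

definition t_closure :: "'k::field set \<Rightarrow> 'k set \<Rightarrow> 'k set" where
  "t_closure R I =
     \<Union> {v_closure R J |J. J \<in> nonzero_fractional_ideals R \<and> finitely_generated R J \<and> J \<subseteq> I}"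

definition fractional_t_ideals :: "'k::field set \<Rightarrow> 'k set set" where
  "fractional_t_ideals R = {I \<in> nonzero_fractional_ideals R. t_closure R I = I}"

definition t_mult :: "'k::field set \<Rightarrow> 'k set \<Rightarrow> 'k set \<Rightarrow> 'k set" where
  "t_mult R I J = t_closure R (ideal_mult R I J)"


subsection \<open>Class semigroups\<close>

text \<open>
  For a semigroup \<open>F\<close> of nonzero fractional ideals, the quotient of \<open>F\<close> by the nonzero principal
  fractional ideals: multiplying by the principal ideal \<open>cR\<close> is scaling by \<open>c\<close>.
\<close>

definition class_rel :: "'k::field set set \<Rightarrow> ('k set \<times> 'k set) set" where
  "class_rel F = {(I, J). I \<in> F \<and> J \<in> F \<and> (\<exists>c. c \<noteq> 0 \<and> I = (\<lambda>x. c * x) ` J)}"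

definition ideal_classes :: "'k::field set set \<Rightarrow> 'k set set set" where
  "ideal_classes F = F // class_rel F"

text \<open>
  The multiplication induced on classes. The union ranges over all choices of representatives; for
  the operations used below all of them give the same class.
\<close>

definition class_mult ::
  "'k::field set set \<Rightarrow> ('k set \<Rightarrow> 'k set \<Rightarrow> 'k set) \<Rightarrow> 'k set set \<Rightarrow> 'k set set \<Rightarrow> 'k set set" where
  "class_mult F f X Y = (\<Union>I\<in>X. \<Union>J\<in>Y. class_rel F `` {f I J})"

definition clifford :: "'s set \<Rightarrow> ('s \<Rightarrow> 's \<Rightarrow> 's) \<Rightarrow> bool" where
  "clifford S f \<longleftrightarrow> (\<forall>x\<in>S. \<exists>a\<in>S. f (f x x) a = x)"

definition boolean :: "'s set \<Rightarrow> ('s \<Rightarrow> 's \<Rightarrow> 's) \<Rightarrow> bool" where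
  "boolean S f \<longleftrightarrow> (\<forall>x\<in>S. f x x = x)"

definition clifford_t_regular :: "'k::field set \<Rightarrow> bool" where
  "clifford_t_regular R \<longleftrightarrow>
     clifford (ideal_classes (fractional_t_ideals R)) (class_mult (fractional_t_ideals R) (t_mult R))"

definition boole_t_regular :: "'k::field set \<Rightarrow> bool" where
  "boole_t_regular R \<longleftrightarrow>
     boolean (ideal_classes (fractional_t_ideals R)) (class_mult (fractional_t_ideals R) (t_mult R))"

definition boole_regular :: "'k::field set \<Rightarrow> bool" where
  "boole_regular R \<longleftrightarrow>
     boolean (ideal_classes (nonzero_fractional_ideals R))
       (class_mult (nonzero_fractional_ideals R) (ideal_mult R))"


subsection \<open>Pseudo-valuation domains\<close>

definition pseudo_valuation_domain :: "'k::field set \<Rightarrow> bool" where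
  "pseudo_valuation_domain R \<longleftrightarrow>
     domain_with_quotient_field R \<and>
     (\<forall>P. prime_ideal_of R P \<longrightarrow> (\<forall>x y. x * y \<in> P \<longrightarrow> x \<in> P \<or> y \<in> P))"

definition valuation_overring :: "'k::field set \<Rightarrow> 'k set \<Rightarrow> bool" where
  "valuation_overring R V \<longleftrightarrow>
     subring_of_field V \<and> R \<subseteq> V \<and> (\<forall>x. x \<noteq> 0 \<longrightarrow> x \<in> V \<or> inverse x \<in> V)"

text \<open>
  For a pseudo-valuation domain exactly one \<open>V\<close> satisfies the description.
\<close>

definition associated_valuation_overring :: "'k::field set \<Rightarrow> 'k set" where
  "associated_valuation_overring R =
     (THE V. valuation_overring R V \<and>
        (\<exists>M. {N. maximal_ideal_of R N} = {M} \<and> {N. maximal_ideal_of V N} = {M}))"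

end

theory Submission
  imports Defs "HOL-Library.Set_Algebras"
begin

text \<open>
  Let \<open>M\<close> be the maximal ideal of the pseudo-valuation domain \<open>R\<close> and \<open>V\<close> its associated valuation
  overring. Write \<open>I * J\<close> for the set of products \<open>x * y\<close> with \<open>x \<in> I\<close> and \<open>y \<in> J\<close>, without sums.

  Everything rests on a description of the \<open>t\<close>-ideals of \<open>R\<close>
  (\<open>fractional_t_ideals_eq\<close>): they are the nonzero principal fractional ideals of \<open>R\<close> together with all
  nonzero fractional ideals of \<open>V\<close>. Indeed, if \<open>x, y \<in> I\<close> with \<open>y / x \<in> V - R\<close>, then whatever multiplies
  \<open>x\<close> and \<open>y\<close> into \<open>R\<close> multiplies \<open>x\<close> into \<open>M\<close>, hence \<open>xV\<close> into \<open>M\<close>; so \<open>(x, y)\<^sub>v\<close> already contains \<open>xV\<close>.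
  Conversely, a finitely generated ideal \<open>J\<close> of \<open>R\<close> has an element \<open>c\<close> of smallest value, and
  \<open>J\<^sub>v\<close> does not leave \<open>cV\<close>.

  For these ideals \<open>(IJ)\<^sub>t\<close> is simply \<open>I * J\<close>: if one factor is principal this is a scaling, and
  if both are ideals of \<open>V\<close>, sums of products are again products, as divisibility in \<open>V\<close> is total.
  So both class semigroups in question consist of sets modulo scaling, multiplied elementwise,
  and the one of \<open>R\<close> is the one of \<open>V\<close> enlarged by the class of \<open>R\<close>, which is idempotent.
  This gives the equivalence in (2) at once.

  For (1), principal ideals are no problem, and for an ideal \<open>I\<close> of \<open>V\<close> put \<open>E = (I : I)\<close> and
  \<open>A = (E : I)\<close>. Clearly \<open>I * I * A \<subseteq> I\<close>, and totality of divisibility shows that every element of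
  \<open>I\<close> is a single product from \<open>I * I * A\<close> (\<open>valuation_ideal_regular\<close>).
\<close>

section \<open>Subrings, submodules and local rings inside a field\<close>

lemma
  assumes "subring_of_field S"
  shows subring_one: "1 \<in> S" and subring_zero: "0 \<in> S"
    and subring_mult: "x \<in> S \<Longrightarrow> y \<in> S \<Longrightarrow> x * y \<in> S"
    and subring_add: "x \<in> S \<Longrightarrow> y \<in> S \<Longrightarrow> x + y \<in> S"
proof -
  show one: "1 \<in> S" and "x \<in> S \<Longrightarrow> y \<in> S \<Longrightarrow> x * y \<in> S"
    using assms unfolding subring_of_field_def by blast+
  have diff: "x \<in> S \<Longrightarrow> y \<in> S \<Longrightarrow> x - y \<in> S" for x y
    using assms unfolding subring_of_field_def by blast
  show zero: "0 \<in> S"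
    using diff[OF one one] by simp
  show "x + y \<in> S" if "x \<in> S" "y \<in> S"
    using diff[OF that(1) diff[OF zero that(2)]] by simp
qed

lemma
  assumes "submodule_of_field S I"
  shows submodule_zero: "0 \<in> I"
    and submodule_add: "x \<in> I \<Longrightarrow> y \<in> I \<Longrightarrow> x + y \<in> I"
    and submodule_scale: "r \<in> S \<Longrightarrow> x \<in> I \<Longrightarrow> r * x \<in> I"
  using assms unfolding submodule_of_field_def by blast+

lemma submodule_restrict_scalars:
  "submodule_of_field V I \<Longrightarrow> S \<subseteq> V \<Longrightarrow> submodule_of_field S I"
  unfolding submodule_of_field_def by blast

lemma submodule_self: "subring_of_field S \<Longrightarrow> submodule_of_field S S"
  unfolding submodule_of_field_def
  by (simp add: subring_zero subring_add subring_mult)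

lemma submodule_scaled:
  fixes c :: "'k::field"
  assumes "submodule_of_field S I"
  shows "submodule_of_field S (c *o I)"
  unfolding submodule_of_field_def
proof (intro conjI ballI)
  show "0 \<in> c *o I"
    using submodule_zero[OF assms] by (force simp: elt_set_times_def)
next
  fix x y assume "x \<in> c *o I" "y \<in> c *o I"
  then obtain a b where ab: "a \<in> I" "b \<in> I" and "x = c * a" "y = c * b"
    by (auto simp: elt_set_times_def)
  then have "x + y = c * (a + b)"
    by (simp add: distrib_left)
  then show "x + y \<in> c *o I"
    using submodule_add[OF assms ab] by auto
next
  fix r x assume r: "r \<in> S" and "x \<in> c *o I"
  then obtain a where a: "a \<in> I" and "x = c * a"
    by (auto simp: elt_set_times_def)
  then have "r * x = c * (r * a)"
    by simp
  then show "r * x \<in> c *o I"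
    using submodule_scale[OF assms r a] by (metis set_times_intro2)
qed

lemma submodule_hull: "submodule_of_field S (submodule_of_field S hull A)"
  by (rule hull_in) (auto simp: submodule_of_field_def)

lemma mem_scaled_iff:
  fixes c :: "'k::field"
  shows "c \<noteq> 0 \<Longrightarrow> x \<in> c *o I \<longleftrightarrow> x / c \<in> I"
  by (force simp: elt_set_times_def field_simps)

lemma nonzero_submoduleE:
  assumes "submodule_of_field S I" "I \<noteq> {0}"
  obtains x where "x \<in> I" "x \<noteq> 0"
  using assms submodule_zero by blast

text \<open>\<open>S\<close> is local with maximal ideal \<open>M\<close>, phrased without quantifying over ideals.\<close>

definition local_ring_with :: "'k::field set \<Rightarrow> 'k set \<Rightarrow> bool" where
  "local_ring_with S M \<longleftrightarrow>
     subring_of_field S \<and> ideal_of S M \<and> 1 \<notin> M \<and> (\<forall>x\<in>S. x \<notin> M \<longrightarrow> inverse x \<in> S)"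

lemma ideal_containing_unit:
  assumes I: "ideal_of S I" and x: "x \<in> I" "x \<noteq> 0" "inverse x \<in> S"
  shows "I = S"
proof -
  have sub: "submodule_of_field S I" "I \<subseteq> S"
    using I by (auto simp: ideal_of_def)
  have one: "1 \<in> I"
    using submodule_scale[OF sub(1) x(3,1)] x(2) by simp
  have "y \<in> I" if "y \<in> S" for y
    using submodule_scale[OF sub(1) that one] by simp
  then show ?thesis
    using sub(2) by blast
qed

lemma local_ring_maximal_ideals:
  assumes "local_ring_with S M"
  shows "{N. maximal_ideal_of S N} = {M}"
proof -
  have S: "subring_of_field S" and M: "ideal_of S M" "1 \<notin> M"
    and units: "\<And>x. x \<in> S \<Longrightarrow> x \<notin> M \<Longrightarrow> inverse x \<in> S"
    using assms by (auto simp: local_ring_with_def)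
  have MS: "M \<noteq> S"
    using M(2) subring_one[OF S] by blast
  have zero: "0 \<in> M"
    using M(1) by (auto simp: ideal_of_def submodule_zero)
  have sub: "N \<subseteq> M" if N: "ideal_of S N" "N \<noteq> S" for N
  proof
    fix x assume x: "x \<in> N"
    then have "x \<in> S"
      using N(1) by (auto simp: ideal_of_def)
    show "x \<in> M"
    proof (rule ccontr)
      assume "x \<notin> M"
      then show False
        using ideal_containing_unit[OF N(1) x] units[OF \<open>x \<in> S\<close>] zero N(2) by auto
    qed
  qed
  then show ?thesis
    unfolding maximal_ideal_of_def using M(1) MS by blast
qed

lemma exists_maximal_ideal_containing:
  assumes S: "subring_of_field S" and I: "ideal_of S I" "I \<noteq> S"
  obtains N where "maximal_ideal_of S N" "I \<subseteq> N"
proof -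
  define \<A> where "\<A> = {N. ideal_of S N \<and> 1 \<notin> N \<and> I \<subseteq> N}"
  have proper: "N = S \<longleftrightarrow> 1 \<in> N" if "ideal_of S N" for N
    using ideal_containing_unit[OF that, of 1] subring_one[OF S] by auto
  have "\<exists>N\<in>\<A>. \<forall>X\<in>\<A>. N \<subseteq> X \<longrightarrow> X = N"
  proof (rule subset_Zorn_nonempty)
    show "\<A> \<noteq> {}"
      using I proper by (auto simp: \<A>_def)
  next
    fix C assume C: "C \<noteq> {}" "subset.chain \<A> C"
    then have CA: "C \<subseteq> \<A>" and total: "\<And>X Y. X \<in> C \<Longrightarrow> Y \<in> C \<Longrightarrow> X \<subseteq> Y \<or> Y \<subseteq> X"
      by (auto simp: subset_chain_def)
    have sub: "submodule_of_field S X" "X \<subseteq> S" "1 \<notin> X" "I \<subseteq> X" if "X \<in> C" for X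
      using CA that by (auto simp: \<A>_def ideal_of_def)
    have "submodule_of_field S (\<Union>C)"
      unfolding submodule_of_field_def
    proof (intro conjI ballI)
      show "0 \<in> \<Union>C"
        using C(1) sub(1) submodule_zero by blast
    next
      fix x y assume "x \<in> \<Union>C" "y \<in> \<Union>C"
      then obtain X Y where XY: "X \<in> C" "Y \<in> C" "x \<in> X" "y \<in> Y"
        by blast
      then show "x + y \<in> \<Union>C"
        using total[OF XY(1,2)] sub(1) submodule_add[of S _ x y] by (metis UnionI subsetD)
    next
      fix r x assume "r \<in> S" "x \<in> \<Union>C"
      then show "r * x \<in> \<Union>C"
        using sub(1) submodule_scale by blast
    qed
    then show "\<Union>C \<in> \<A>"
      using C(1) sub unfolding \<A>_def ideal_of_def by blast
  qed
  then obtain N where N: "N \<in> \<A>" and max: "\<And>X. X \<in> \<A> \<Longrightarrow> N \<subseteq> X \<Longrightarrow> X = N"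
    by blast
  have "maximal_ideal_of S N"
    unfolding maximal_ideal_of_def
  proof (intro conjI allI impI)
    show "ideal_of S N" "N \<noteq> S"
      using N proper by (auto simp: \<A>_def)
  next
    fix X assume X: "ideal_of S X \<and> N \<subseteq> X"
    then show "X = N \<or> X = S"
      using max[of X] proper[of X] N by (auto simp: \<A>_def)
  qed
  then show thesis
    using that N by (auto simp: \<A>_def)
qed

lemma maximal_ideal_is_prime:
  assumes S: "subring_of_field S" and N: "maximal_ideal_of S N"
  shows "prime_ideal_of S N"
  unfolding prime_ideal_of_def
proof (intro conjI ballI impI)
  show "ideal_of S N" "N \<noteq> S"
    using N by (auto simp: maximal_ideal_of_def)
  then have sub: "submodule_of_field S N" "N \<subseteq> S"
    by (auto simp: ideal_of_def)
  fix a b assume ab: "a \<in> S" "b \<in> S" "a * b \<in> N"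
  show "a \<in> N \<or> b \<in> N"
  proof (rule ccontr)
    assume not: "\<not> (a \<in> N \<or> b \<in> N)"
    define X where "X = {n + r * a |n r. n \<in> N \<and> r \<in> S}"
    have "N \<subseteq> X"
    proof
      fix n assume "n \<in> N"
      then show "n \<in> X"
        unfolding X_def by (intro CollectI exI[of _ n] exI[of _ 0]) (simp add: subring_zero[OF S])
    qed
    have "a \<in> X"
      unfolding X_def by (intro CollectI exI[of _ 0] exI[of _ 1])
        (simp add: subring_one[OF S] submodule_zero[OF sub(1)])
    have "ideal_of S X"
      unfolding ideal_of_def submodule_of_field_def
    proof (intro conjI ballI subsetI)
      show "0 \<in> X"
        using \<open>N \<subseteq> X\<close> submodule_zero[OF sub(1)] by blast
    next
      fix x y assume "x \<in> X" "y \<in> X"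
      then obtain n r n' r' where *: "x = n + r * a" "y = n' + r' * a"
        "n \<in> N" "n' \<in> N" "r \<in> S" "r' \<in> S"
        by (auto simp: X_def)
      then show "x + y \<in> X"
        unfolding X_def by (intro CollectI exI[of _ "n + n'"] exI[of _ "r + r'"])
          (simp add: subring_add[OF S] submodule_add[OF sub(1)] algebra_simps)
    next
      fix s x assume s: "s \<in> S" and "x \<in> X"
      then obtain n r where *: "x = n + r * a" "n \<in> N" "r \<in> S"
        by (auto simp: X_def)
      then show "s * x \<in> X"
        unfolding X_def by (intro CollectI exI[of _ "s * n"] exI[of _ "s * r"])
          (simp add: s subring_mult[OF S] submodule_scale[OF sub(1)] distrib_left mult.assoc)
    next
      fix x assume "x \<in> X"
      then show "x \<in> S"
        using sub(2) ab(1) by (auto simp: X_def subring_add[OF S] subring_mult[OF S])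
    qed
    then have "X = S"
      using N \<open>N \<subseteq> X\<close> \<open>a \<in> X\<close> not unfolding maximal_ideal_of_def by blast
    then have "1 \<in> X"
      using subring_one[OF S] by simp
    then obtain n r where nr: "1 = n + r * a" "n \<in> N" "r \<in> S"
      unfolding X_def by blast
    have "b = (n + r * a) * b"
      using nr(1) by simp
    also have "\<dots> = b * n + r * (a * b)"
      by (simp add: algebra_simps)
    also have "\<dots> \<in> N"
      using nr ab by (simp add: submodule_add[OF sub(1)] submodule_scale[OF sub(1)])
    finally show False
      using not by blast
  qed
qed

section \<open>Classes modulo scaling\<close>

lemma class_rel_iff:
  "(I, J) \<in> class_rel F \<longleftrightarrow> I \<in> F \<and> J \<in> F \<and> (\<exists>c. c \<noteq> 0 \<and> I = c *o J)"
  by (auto simp: class_rel_def elt_set_times_def image_def)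

text \<open>
  The situation in which a semigroup of fractional ideals induces a class semigroup whose product is
  the elementwise one: only sets and scalings remain.
\<close>

locale elementwise_semigroup =
  fixes F :: "'k::field set set" and f :: "'k set \<Rightarrow> 'k set \<Rightarrow> 'k set"
  assumes closed: "I \<in> F \<Longrightarrow> J \<in> F \<Longrightarrow> I * J \<in> F"
    and elementwise: "I \<in> F \<Longrightarrow> J \<in> F \<Longrightarrow> f I J = I * J"
begin

abbreviation ideal_class :: "'k set \<Rightarrow> 'k set set" where
  "ideal_class I \<equiv> class_rel F `` {I}"

lemma equiv_class_rel: "equiv F (class_rel F)"
proof (rule equivI)
  show "class_rel F \<subseteq> F \<times> F"
    by (auto simp: class_rel_iff)
  show "refl_on F (class_rel F)"
    by (auto simp: refl_on_def class_rel_iff intro!: exI[of _ 1])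
  show "sym (class_rel F)"
  proof (rule symI)
    fix I J assume "(I, J) \<in> class_rel F"
    then obtain c where "I \<in> F" "J \<in> F" "c \<noteq> 0" "I = c *o J"
      by (auto simp: class_rel_iff)
    then show "(J, I) \<in> class_rel F"
      by (auto simp: class_rel_iff set_times_rearrange2 intro!: exI[of _ "inverse c"])
  qed
  show "trans (class_rel F)"
  proof (rule transI)
    fix I J L assume "(I, J) \<in> class_rel F" "(J, L) \<in> class_rel F"
    then obtain c d where "I \<in> F" "L \<in> F" "c \<noteq> 0" "d \<noteq> 0" "I = c *o J" "J = d *o L"
      by (auto simp: class_rel_iff)
    then show "(I, L) \<in> class_rel F"
      by (auto simp: class_rel_iff set_times_rearrange2 intro!: exI[of _ "c * d"])
  qed
qed

lemma ideal_class_eq_iff: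
  "I \<in> F \<Longrightarrow> J \<in> F \<Longrightarrow> ideal_class I = ideal_class J \<longleftrightarrow> (\<exists>c. c \<noteq> 0 \<and> I = c *o J)"
  using eq_equiv_class_iff[OF equiv_class_rel, of I J] by (simp add: class_rel_iff)

lemma class_mult_ideal_class:
  assumes "I \<in> F" "J \<in> F"
  shows "class_mult F f (ideal_class I) (ideal_class J) = ideal_class (I * J)"
proof -
  have "ideal_class (f I' J') = ideal_class (I * J)"
    if "I' \<in> ideal_class I" "J' \<in> ideal_class J" for I' J'
  proof -
    obtain c d where *: "c \<noteq> 0" "d \<noteq> 0" "I = c *o I'" "J = d *o J'" "I' \<in> F" "J' \<in> F"
      using \<open>I' \<in> ideal_class I\<close> \<open>J' \<in> ideal_class J\<close> by (auto simp: class_rel_iff)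
    have "I * J = (c * d) *o (I' * J')"
      using * by (simp add: set_times_rearrange)
    then have "ideal_class (I * J) = ideal_class (I' * J')"
      using *(1,2,5,6) assms closed ideal_class_eq_iff[of "I * J" "I' * J'"]
      by (metis mult_eq_0_iff)
    then show ?thesis
      using * elementwise by simp
  qed
  moreover have "I \<in> ideal_class I" "J \<in> ideal_class J"
    using assms equiv_class_self[OF equiv_class_rel] by auto
  ultimately show ?thesis
    unfolding class_mult_def by blast
qed

lemma boolean_iff:
  "boolean (ideal_classes F) (class_mult F f) \<longleftrightarrow> (\<forall>I\<in>F. \<exists>c. c \<noteq> 0 \<and> I * I = c *o I)"
proof -
  have "boolean (ideal_classes F) (class_mult F f) \<longleftrightarrow>
      (\<forall>I\<in>F. ideal_class (I * I) = ideal_class I)"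
    by (auto simp: boolean_def ideal_classes_def quotient_def class_mult_ideal_class)
  then show ?thesis
    by (simp add: ideal_class_eq_iff closed)
qed

lemma cliffordI:
  assumes "\<And>I. I \<in> F \<Longrightarrow> \<exists>A\<in>F. I * I * A = I"
  shows "clifford (ideal_classes F) (class_mult F f)"
proof -
  have "\<exists>A\<in>F. class_mult F f (class_mult F f (ideal_class I) (ideal_class I)) (ideal_class A)
      = ideal_class I" if "I \<in> F" for I
    using assms[OF that] that by (metis class_mult_ideal_class closed)
  then show ?thesis
    by (auto simp: clifford_def ideal_classes_def quotient_def)
qed

end

section \<open>Ideals of a valuation ring\<close>

text \<open>
  A valuation ring is given here by totality alone; its field of fractions is then the whole type.
\<close>

locale valuation_ring =
  fixes V :: "'k::field set"
  assumes subring: "subring_of_field V"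
    and total: "x \<noteq> 0 \<Longrightarrow> x \<in> V \<or> inverse x \<in> V"
begin

lemma total_divide: "x \<noteq> 0 \<Longrightarrow> y \<noteq> 0 \<Longrightarrow> x / y \<in> V \<or> y / x \<in> V"
  using total[of "x / y"] by simp

lemma divisibleE:
  obtains v where "v \<in> V" "x = v * y" | v where "v \<in> V" "y = v * x"
proof (cases "x = 0 \<or> y = 0")
  case True
  then show thesis
    using that subring_zero[OF subring] by force
next
  case False
  then have "x = x / y * y" "y = y / x * x"
    by auto
  then show thesis
    using that total_divide False by blast
qed

text \<open>
  In \<open>x * y + x' * y'\<close> one of \<open>x, x'\<close> divides the other, and so does one of \<open>y, y'\<close>; in each of the
  four cases the sum collapses to one product.
\<close>

lemma submodule_elementwise_product:
  assumes I: "submodule_of_field V I" and J: "submodule_of_field V J"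
  shows "submodule_of_field V (I * J)"
  unfolding submodule_of_field_def
proof (intro conjI ballI)
  show "0 \<in> I * J"
    using set_times_intro[OF submodule_zero[OF I] submodule_zero[OF J]] by simp
next
  fix p q assume "p \<in> I * J" "q \<in> I * J"
  then obtain x y x' y' where p: "p = x * y" "x \<in> I" "y \<in> J" and q: "q = x' * y'" "x' \<in> I" "y' \<in> J"
    by (auto elim!: set_times_elim)
  note intros = set_times_intro submodule_scale[OF I] submodule_scale[OF J] p q
    subring_add[OF subring] subring_mult[OF subring] subring_one[OF subring]
  show "p + q \<in> I * J"
  proof (rule divisibleE[of x x']; rule divisibleE[of y y'])
    fix v w assume "v \<in> V" "x = v * x'" "w \<in> V" "y = w * y'"
    then have "p + q = x' * ((v * w + 1) * y')" "v * w + 1 \<in> V"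
      using p q by (auto simp: algebra_simps intro!: intros)
    then show ?thesis using intros by metis
  next
    fix v w assume "v \<in> V" "x = v * x'" "w \<in> V" "y' = w * y"
    then have "p + q = x' * ((v + w) * y)" "v + w \<in> V"
      using p q by (auto simp: algebra_simps intro!: intros)
    then show ?thesis using intros by metis
  next
    fix v w assume "v \<in> V" "x' = v * x" "w \<in> V" "y = w * y'"
    then have "p + q = x * ((v + w) * y')" "v + w \<in> V"
      using p q by (auto simp: algebra_simps intro!: intros)
    then show ?thesis using intros by metis
  next
    fix v w assume "v \<in> V" "x' = v * x" "w \<in> V" "y' = w * y"
    then have "p + q = x * ((1 + v * w) * y)" "1 + v * w \<in> V"
      using p q by (auto simp: algebra_simps intro!: intros)
    then show ?thesis using intros by metis
  qed
next
  fix r p assume r: "r \<in> V" and "p \<in> I * J"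
  then obtain x y where "p = x * y" "x \<in> I" "y \<in> J"
    by (auto elim!: set_times_elim)
  then have "r * p = (r * x) * y" "r * x \<in> I" "y \<in> J"
    using submodule_scale[OF I r] by auto
  then show "r * p \<in> I * J"
    by (metis set_times_intro)
qed

lemma finite_set_has_least_value:
  assumes "finite S" "S \<noteq> {}"
  obtains c where "c \<in> S" "S \<subseteq> c *o V"
proof -
  have "\<exists>c\<in>S. \<forall>x\<in>S. \<exists>v\<in>V. x = c * v"
    using assms
  proof (induction rule: finite_ne_induct)
    case (singleton x)
    then show ?case
      using subring_one[OF subring] by force
  next
    case (insert x S)
    then obtain c where c: "c \<in> S" "\<And>y. y \<in> S \<Longrightarrow> \<exists>v\<in>V. y = c * v"
      by blast
    show ?case
    proof (rule divisibleE[of c x])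
      fix v assume v: "v \<in> V" "c = v * x"
      have "\<exists>w\<in>V. y = x * w" if "y \<in> insert x S" for y
      proof (cases "y = x")
        case True
        then show ?thesis
          using subring_one[OF subring] by force
      next
        case False
        then obtain u where "u \<in> V" "y = c * u"
          using c(2) \<open>y \<in> insert x S\<close> by blast
        then show ?thesis
          using v subring_mult[OF subring] by (intro bexI[of _ "v * u"]) auto
      qed
      then show ?case by blast
    next
      fix v assume "v \<in> V" "x = v * c"
      then have "\<forall>y\<in>insert x S. \<exists>v\<in>V. y = c * v"
        using c(2) by (auto simp: mult.commute)
      then show ?case
        using c(1) by blast
    qed
  qed
  then show thesis
    using that by (auto simp: elt_set_times_def)
qed

lemma submodule_colon:
  assumes "submodule_of_field V I"
  shows "submodule_of_field V (ideal_colon I J)"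
  unfolding submodule_of_field_def ideal_colon_def
  using submodule_zero[OF assms] submodule_add[OF assms] submodule_scale[OF assms]
  by (auto simp: distrib_right mult.assoc)

text \<open>
  With \<open>E = (I : I)\<close> and \<open>A = (E : I)\<close>, take \<open>x \<in> I\<close> nonzero. If \<open>I \<subseteq> xE\<close> then \<open>1 / x \<in> A\<close>, and
  \<open>x = x * x * (1 / x)\<close>. Otherwise some \<open>y \<in> I\<close> has \<open>y / x \<notin> E\<close>, so that \<open>y / x\<close> moves some \<open>z \<in> I\<close> out
  of \<open>I\<close>; by totality of divisibility \<open>y * z / x\<close> then divides all of \<open>I\<close>, which puts
  \<open>x / (y * z)\<close> into \<open>A\<close>.
\<close>

lemma valuation_ideal_regular:
  assumes I: "submodule_of_field V I"
  defines "A \<equiv> ideal_colon (ideal_colon I I) I"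
  shows "I * I * A = I"
proof
  define E where "E = ideal_colon I I"
  have VE: "v \<in> E" if "v \<in> V" for v
    using submodule_scale[OF I that] by (auto simp: E_def ideal_colon_def)
  have EI: "e * x \<in> I" if "e \<in> E" "x \<in> I" for e x
    using that by (auto simp: E_def ideal_colon_def)
  have A: "a \<in> A \<longleftrightarrow> (\<forall>x\<in>I. a * x \<in> E)" for a
    by (auto simp: A_def E_def ideal_colon_def)
  show "I * I * A \<subseteq> I"
  proof
    fix p assume "p \<in> I * I * A"
    then obtain x y a where *: "p = x * y * a" "x \<in> I" "y \<in> I" "a \<in> A"
      by (auto elim!: set_times_elim)
    then have "p = (a * x) * y"
      by simp
    then show "p \<in> I"
      using * A EI by metis
  qed
  show "I \<subseteq> I * I * A"
  proof
    fix x assume x: "x \<in> I"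
    show "x \<in> I * I * A"
    proof (cases "x = 0")
      case True
      have "0 * 0 * 0 \<in> I * I * A"
        using submodule_zero[OF I] VE[OF subring_zero[OF subring]] A
        by (intro set_times_intro) auto
      then show ?thesis
        using True by simp
    next
      case x0: False
      show ?thesis
      proof (cases "\<forall>y\<in>I. y / x \<in> E")
        case True
        then have "1 / x \<in> A"
          by (simp add: A)
        then have "x * x * (1 / x) \<in> I * I * A"
          using x by (intro set_times_intro)
        then show ?thesis
          using x0 by simp
      next
        case False
        then obtain y where y: "y \<in> I" "y / x \<notin> E"
          by blast
        then obtain z where z: "z \<in> I" "y / x * z \<notin> I"
          by (auto simp: E_def ideal_colon_def)
        have nz: "y \<noteq> 0" "z \<noteq> 0"
          using z submodule_zero[OF I] by auto
        define a where "a = x / (y * z)"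
        have "a * w \<in> E" if w: "w \<in> I" for w
        proof (cases "w = 0")
          case True
          then show ?thesis
            using VE[OF subring_zero[OF subring]] by simp
        next
          case False
          have "a * w \<in> V"
          proof (rule ccontr)
            assume "a * w \<notin> V"
            then have "inverse (a * w) \<in> V"
              using total[of "a * w"] False x0 nz by (auto simp: a_def)
            then have "inverse (a * w) * w \<in> I"
              using submodule_scale[OF I] w by blast
            moreover have "inverse (a * w) * w = y / x * z"
              using False x0 nz by (simp add: a_def field_simps)
            ultimately show False
              using z by simp
          qed
          then show ?thesis
            by (rule VE)
        qed
        then have "y * z * a \<in> I * I * A"
          using y z A by (intro set_times_intro) auto
        then show ?thesis
          using nz by (simp add: a_def)
      qed
    qed
  qed
qed

definition nonunits :: "'k set" where
  "nonunits = {x \<in> V. x = 0 \<or> inverse x \<notin> V}"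

lemma local_nonunits: "local_ring_with V nonunits"
proof -
  have mult: "r * x \<in> nonunits" if r: "r \<in> V" and x: "x \<in> nonunits" for r x
  proof -
    have "inverse x \<in> V" if "r * x \<noteq> 0" "inverse (r * x) \<in> V"
    proof -
      have "inverse x = r * inverse (r * x)"
        using that(1) by (simp add: field_simps)
      then show ?thesis
        using subring_mult[OF subring r that(2)] by metis
    qed
    then show ?thesis
      using r x subring_mult[OF subring] by (auto simp: nonunits_def)
  qed
  have add: "x + y \<in> nonunits" if "x \<in> nonunits" "y \<in> nonunits" for x y
  proof (rule divisibleE[of x y])
    fix v assume "v \<in> V" "x = v * y"
    then have "x + y = (v + 1) * y" "v + 1 \<in> V"
      by (auto simp: distrib_right subring_add subring_one subring)
    then show ?thesis
      using mult that by metis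
  next
    fix v assume "v \<in> V" "y = v * x"
    then have "x + y = (1 + v) * x" "1 + v \<in> V"
      by (auto simp: distrib_right subring_add subring_one subring)
    then show ?thesis
      using mult that by metis
  qed
  show ?thesis
    unfolding local_ring_with_def ideal_of_def submodule_of_field_def
    using subring mult add subring_zero[OF subring] subring_one[OF subring]
    by (auto simp: nonunits_def)
qed

end

section \<open>A pseudo-valuation domain and its valuation overring\<close>

lemma quotient_fieldE:
  assumes "domain_with_quotient_field R"
  obtains a b where "a \<in> R" "b \<in> R" "b \<noteq> 0" "x = a / b"
  using assms unfolding domain_with_quotient_field_def by blast

lemma fractional_ideal_iff:
  assumes R: "domain_with_quotient_field R"
  shows "fractional_ideal R I \<longleftrightarrow>
    submodule_of_field R I \<and> (\<exists>d. d \<noteq> 0 \<and> (\<forall>x\<in>I. d * x \<in> R))"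
proof -
  have sub: "subring_of_field R"
    using R by (simp add: domain_with_quotient_field_def)
  have "\<exists>e\<in>R. e \<noteq> 0 \<and> (\<forall>x\<in>I. e * x \<in> R)" if d: "d \<noteq> 0" "\<forall>x\<in>I. d * x \<in> R" for d
  proof -
    obtain a b where ab: "a \<in> R" "b \<in> R" "b \<noteq> 0" "d = a / b"
      using R by (rule quotient_fieldE)
    have "a * x \<in> R" if "x \<in> I" for x
    proof -
      have "a * x = b * (d * x)"
        using ab by simp
      then show ?thesis
        using subring_mult[OF sub ab(2)] d(2) that by metis
    qed
    then show ?thesis
      using ab d(1) by (intro bexI[of _ a]) auto
  qed
  then show ?thesis
    unfolding fractional_ideal_def by blast
qed

lemma mem_v_closure_iff:
  "x \<in> v_closure R I \<longleftrightarrow> (\<forall>w. (\<forall>y\<in>I. w * y \<in> R) \<longrightarrow> x * w \<in> R)"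
  by (auto simp: v_closure_def ideal_inverse_def ideal_colon_def)

lemma v_closure_extensive: "I \<subseteq> v_closure R I"
  unfolding subset_iff mem_v_closure_iff by (metis mult.commute)

lemma v_closure_subset_principal:
  fixes c :: "'k::field"
  assumes "c \<noteq> 0" "J \<subseteq> c *o R"
  shows "v_closure R J \<subseteq> c *o R"
proof
  fix x assume "x \<in> v_closure R J"
  moreover have "\<forall>y\<in>J. inverse c * y \<in> R"
    using assms by (auto simp: mem_scaled_iff field_simps)
  ultimately have "x * inverse c \<in> R"
    by (auto simp: mem_v_closure_iff)
  then show "x \<in> c *o R"
    using assms(1) by (simp add: mem_scaled_iff field_simps)
qed

text \<open>
  Two local rings \<open>R \<subseteq> V\<close> with the same maximal ideal \<open>M\<close>, where \<open>V\<close> is a valuation ring.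
  The case \<open>R = V\<close> is included.
\<close>

locale pvd_pair =
  fixes R V M :: "'k::field set"
  assumes quotient_field: "domain_with_quotient_field R"
    and local_R: "local_ring_with R M"
    and local_V: "local_ring_with V M"
    and R_subset_V: "R \<subseteq> V"
    and inverse_outside: "x \<notin> V \<Longrightarrow> inverse x \<in> M"

sublocale pvd_pair \<subseteq> valuation_ring V
proof
  show "subring_of_field V"
    using local_V by (simp add: local_ring_with_def)
  show "x \<in> V \<or> inverse x \<in> V" for x
    using inverse_outside[of x] local_V by (auto simp: local_ring_with_def ideal_of_def)
qed

context pvd_pair
begin

lemma subring_R: "subring_of_field R"
  and M_subset_R: "M \<subseteq> R"
  and one_notin_M: "1 \<notin> M"
  and inverse_R: "r \<in> R \<Longrightarrow> r \<notin> M \<Longrightarrow> inverse r \<in> R"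
  and submodule_V_M: "submodule_of_field V M"
  using local_R local_V by (auto simp: local_ring_with_def ideal_of_def)

lemma M_absorbs:
  "v \<in> V \<Longrightarrow> m \<in> M \<Longrightarrow> v * m \<in> M" "v \<in> V \<Longrightarrow> m \<in> M \<Longrightarrow> m * v \<in> M"
  using submodule_scale[OF submodule_V_M] by (metis mult.commute)+

lemma quotient_field_V: "domain_with_quotient_field V"
  using quotient_field subring R_subset_V unfolding domain_with_quotient_field_def by blast

text \<open>
  If \<open>M\<close> contains \<open>m \<noteq> 0\<close>, then \<open>m * V \<subseteq> M\<close>; if not, \<open>R\<close> is a field and equals \<open>V\<close>.
\<close>

lemma conductor_nonzero:
  obtains m where "m \<noteq> 0" "\<And>v. v \<in> V \<Longrightarrow> m * v \<in> R"
proof (cases "M \<subseteq> {0}")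
  case False
  then show thesis
    using that M_absorbs(2) M_subset_R by blast
next
  case True
  have "x \<in> R" for x
  proof -
    obtain a b where ab: "a \<in> R" "b \<in> R" "b \<noteq> 0" "x = a / b"
      using quotient_field by (rule quotient_fieldE)
    then have "inverse b \<in> R"
      using True inverse_R by blast
    then show ?thesis
      using subring_mult[OF subring_R ab(1)] ab(4) by (simp add: divide_inverse)
  qed
  then show thesis
    using that[of 1] by simp
qed

lemma nonzero_fractional_ideals_R:
  "I \<in> nonzero_fractional_ideals R \<longleftrightarrow>
    submodule_of_field R I \<and> I \<noteq> {0} \<and> (\<exists>d. d \<noteq> 0 \<and> (\<forall>x\<in>I. d * x \<in> R))"
  by (auto simp: nonzero_fractional_ideals_def fractional_ideal_iff[OF quotient_field])

lemma nonzero_fractional_ideals_V: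
  "I \<in> nonzero_fractional_ideals V \<longleftrightarrow>
    submodule_of_field V I \<and> I \<noteq> {0} \<and> (\<exists>d. d \<noteq> 0 \<and> (\<forall>x\<in>I. d * x \<in> R))"
proof -
  obtain m where m: "m \<noteq> 0" "\<And>v. v \<in> V \<Longrightarrow> m * v \<in> R"
    using conductor_nonzero by blast
  have "\<exists>e. e \<noteq> 0 \<and> (\<forall>x\<in>I. e * x \<in> R)" if "d \<noteq> 0" "\<forall>x\<in>I. d * x \<in> V" for d
    using that m by (intro exI[of _ "m * d"]) (auto simp: mult.assoc)
  then have "(\<exists>d. d \<noteq> 0 \<and> (\<forall>x\<in>I. d * x \<in> V)) \<longleftrightarrow> (\<exists>d. d \<noteq> 0 \<and> (\<forall>x\<in>I. d * x \<in> R))"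
    using R_subset_V by blast
  then show ?thesis
    by (auto simp: nonzero_fractional_ideals_def fractional_ideal_iff[OF quotient_field_V])
qed

lemma nonzero_fractional_ideals_V_subset:
  "nonzero_fractional_ideals V \<subseteq> nonzero_fractional_ideals R"
  using submodule_restrict_scalars[OF _ R_subset_V]
  by (auto simp: nonzero_fractional_ideals_R nonzero_fractional_ideals_V)

lemma principal_nonzero_fractional:
  assumes "c \<noteq> 0"
  shows "c *o R \<in> nonzero_fractional_ideals R"
  unfolding nonzero_fractional_ideals_R
proof (intro conjI)
  show "submodule_of_field R (c *o R)"
    by (rule submodule_scaled[OF submodule_self[OF subring_R]])
  have "c \<in> c *o R"
    using assms subring_one[OF subring_R] by (simp add: mem_scaled_iff)
  then show "c *o R \<noteq> {0}"
    using assms by blast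
  show "\<exists>d. d \<noteq> 0 \<and> (\<forall>x\<in>c *o R. d * x \<in> R)"
    using assms by (intro exI[of _ "inverse c"]) (auto simp: mem_scaled_iff field_simps)
qed

lemma finitely_generated_subideal:
  assumes I: "I \<in> nonzero_fractional_ideals R" and S: "finite S" "S \<subseteq> I" "x \<in> S" "x \<noteq> 0"
  defines "J \<equiv> submodule_of_field R hull S"
  shows "J \<in> nonzero_fractional_ideals R" "finitely_generated R J" "J \<subseteq> I"
proof -
  have sub: "submodule_of_field R I"
    using I by (simp add: nonzero_fractional_ideals_R)
  show "J \<subseteq> I"
    unfolding J_def using S(2) sub by (rule hull_minimal)
  show "finitely_generated R J"
    using S(1) by (auto simp: finitely_generated_def J_def)
  have "x \<in> J"
    using S(3) by (simp add: J_def hull_inc)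
  then show "J \<in> nonzero_fractional_ideals R"
    using I S(4) \<open>J \<subseteq> I\<close> submodule_hull[of R S]
    by (auto simp: nonzero_fractional_ideals_R J_def[symmetric])
qed

lemma subset_t_closure:
  assumes I: "I \<in> nonzero_fractional_ideals R"
  shows "I \<subseteq> t_closure R I"
proof
  fix x assume x: "x \<in> I"
  obtain y where y: "y \<in> I" "y \<noteq> 0"
    using I nonzero_submoduleE unfolding nonzero_fractional_ideals_R by metis
  \<comment> \<open>Adjoining \<open>y\<close> keeps the ideal nonzero when \<open>x = 0\<close>.\<close>
  define J where "J = submodule_of_field R hull {x, y}"
  have J: "J \<in> nonzero_fractional_ideals R" "finitely_generated R J" "J \<subseteq> I"
    unfolding J_def using finitely_generated_subideal[OF I, of "{x, y}" y] x y by simp_all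
  have "x \<in> v_closure R J"
    using v_closure_extensive[of J R] hull_inc[of x "{x, y}"] by (auto simp: J_def)
  then show "x \<in> t_closure R I"
    unfolding t_closure_def using J by blast
qed

section \<open>The t-ideals of a pseudo-valuation domain\<close>

text \<open>
  If \<open>z * M\<close> meets the units of \<open>R\<close>, then \<open>inverse z\<close> generates \<open>M\<close> over \<open>R\<close>, and \<open>M * V \<subseteq> M\<close> forces
  \<open>V \<subseteq> R\<close>. Otherwise \<open>z\<close> maps \<open>M\<close> into itself, which elements outside \<open>V\<close> never do.
\<close>

lemma colon_M_subset_V:
  assumes u: "u \<in> V" "u \<notin> R" and z: "\<And>m. m \<in> M \<Longrightarrow> z * m \<in> R"
  shows "z \<in> V"
proof (cases "\<exists>m\<in>M. z * m \<notin> M")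
  case True
  then obtain m where m: "m \<in> M" "z * m \<in> R" "z * m \<notin> M"
    using z by blast
  have nz: "z * m \<noteq> 0"
    using m(3) submodule_zero[OF submodule_V_M] by metis
  have "inverse z = inverse (z * m) * m"
    using nz by simp
  moreover have "inverse (z * m) \<in> V"
    using inverse_R[OF m(2,3)] R_subset_V by blast
  ultimately have "inverse z \<in> M"
    using M_absorbs(1) m(1) by metis
  then have "z * (u * inverse z) \<in> R"
    using z M_absorbs(1) u(1) by blast
  moreover have "z * (u * inverse z) = u"
    using nz by simp
  ultimately show ?thesis
    using u(2) by simp
next
  case False
  show ?thesis
  proof (rule ccontr)
    assume "z \<notin> V"
    then have "inverse z \<in> M" "z \<noteq> 0"
      using inverse_outside subring_zero[OF subring] by auto
    then have "z * inverse z \<in> M"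
      using False by blast
    then show False
      using \<open>z \<noteq> 0\<close> one_notin_M by simp
  qed
qed

text \<open>
  Either \<open>J\<close> lies in \<open>cR\<close>, which is divisorial, or \<open>(R : J)\<close> contains \<open>M / c\<close> and
  \<open>(R : M) = V\<close>.
\<close>

lemma v_closure_least_value:
  assumes c: "c \<noteq> 0" and J: "J \<subseteq> c *o V"
  shows "v_closure R J \<subseteq> c *o V"
proof (cases "J \<subseteq> c *o R")
  case True
  have "c *o R \<subseteq> c *o V"
    using R_subset_V by (auto simp: elt_set_times_def)
  then show ?thesis
    using v_closure_subset_principal[OF c True] by blast
next
  case False
  then obtain y where y: "y \<in> J" "y \<notin> c *o R"
    by blast
  then have u: "y / c \<in> V" "y / c \<notin> R"
    using J c by (auto simp: mem_scaled_iff)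
  show ?thesis
  proof
    fix x assume x: "x \<in> v_closure R J"
    have "x / c * m \<in> R" if m: "m \<in> M" for m
    proof -
      have "m / c * y \<in> R" if "y \<in> J" for y
      proof -
        have "y / c \<in> V"
          using J that c by (auto simp: mem_scaled_iff)
        then have "m * (y / c) \<in> R"
          using M_absorbs(2) m M_subset_R by blast
        then show ?thesis
          by simp
      qed
      then have "x * (m / c) \<in> R"
        using x unfolding mem_v_closure_iff by blast
      then show ?thesis
        by simp
    qed
    then have "x / c \<in> V"
      by (rule colon_M_subset_V[OF u])
    then show "x \<in> c *o V"
      using c by (simp add: mem_scaled_iff)
  qed
qed

lemma t_closure_V_ideal:
  assumes I: "I \<in> nonzero_fractional_ideals V"
  shows "t_closure R I = I"
proof
  have IR: "I \<in> nonzero_fractional_ideals R"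
    using I nonzero_fractional_ideals_V_subset by blast
  have IV: "submodule_of_field V I"
    using I by (simp add: nonzero_fractional_ideals_V)
  show "I \<subseteq> t_closure R I"
    using IR by (rule subset_t_closure)
  show "t_closure R I \<subseteq> I"
    unfolding t_closure_def
  proof clarify
    fix x J assume x: "x \<in> v_closure R J" and J: "J \<in> nonzero_fractional_ideals R"
      "finitely_generated R J" "J \<subseteq> I"
    then obtain S where S: "finite S" "J = submodule_of_field R hull S"
      by (auto simp: finitely_generated_def)
    have "S \<noteq> {}"
    proof
      assume "S = {}"
      moreover have "submodule_of_field R {0}"
        by (simp add: submodule_of_field_def)
      ultimately have "J \<subseteq> {0}"
        using S(2) hull_minimal[of S "{0}" "submodule_of_field R"] by simp
      then show False
        using J(1) nonzero_submoduleE[of R J] by (auto simp: nonzero_fractional_ideals_R)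
    qed
    then obtain c where c: "c \<in> S" "S \<subseteq> c *o V"
      using finite_set_has_least_value S(1) by metis
    have "submodule_of_field R (c *o V)"
      by (rule submodule_restrict_scalars[OF submodule_scaled[OF submodule_self[OF subring]] R_subset_V])
    then have JV: "J \<subseteq> c *o V"
      unfolding S(2) using c(2) by (intro hull_minimal)
    have "c \<noteq> 0"
    proof
      assume "c = 0"
      then have "J \<subseteq> {0}"
        using JV by (auto simp: elt_set_times_def)
      then show False
        using J(1) nonzero_submoduleE[of R J] by (auto simp: nonzero_fractional_ideals_R)
    qed
    then obtain v where v: "v \<in> V" "x = c * v"
      using v_closure_least_value[OF _ JV] x by (auto simp: elt_set_times_def)
    have "c \<in> I"
      using hull_inc[OF c(1), of "submodule_of_field R"] J(3) S(2) by auto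
    then show "x \<in> I"
      using submodule_scale[OF IV v(1)] v(2) by (simp add: mult.commute)
  qed
qed

lemma t_closure_principal:
  assumes c: "c \<noteq> 0"
  shows "t_closure R (c *o R) = c *o R"
proof
  show "t_closure R (c *o R) \<subseteq> c *o R"
    unfolding t_closure_def using v_closure_subset_principal[OF c] by blast
  show "c *o R \<subseteq> t_closure R (c *o R)"
    by (rule subset_t_closure[OF principal_nonzero_fractional[OF c]])
qed

text \<open>
  Given \<open>x \<in> I\<close> nonzero, pick \<open>y \<in> I - xR\<close>. If \<open>y\<close> has smaller value than \<open>x\<close>, then \<open>xV \<subseteq> yM \<subseteq> I\<close>. Otherwise
  \<open>y / x \<in> V - R\<close>, and any \<open>w\<close> with \<open>w * x, w * y \<in> R\<close> has \<open>w * x \<in> M\<close>, since a unit \<open>w * x\<close> would put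
  \<open>y / x\<close> into \<open>R\<close>; so \<open>xV \<subseteq> (x, y)\<^sub>v \<subseteq> I\<close>.
\<close>

lemma nonprincipal_t_ideal:
  assumes I: "I \<in> nonzero_fractional_ideals R" and t: "t_closure R I = I"
    and nonprincipal: "\<And>c. c \<noteq> 0 \<Longrightarrow> I \<noteq> c *o R"
  shows "submodule_of_field V I"
proof -
  have sub: "submodule_of_field R I"
    using I by (simp add: nonzero_fractional_ideals_R)
  have "v * x \<in> I" if v: "v \<in> V" and x: "x \<in> I" for v x
  proof (cases "x = 0")
    case True
    then show ?thesis
      using x by simp
  next
    case x0: False
    have "x *o R \<subseteq> I"
      using submodule_scale[OF sub _ x] by (auto simp: elt_set_times_def mult.commute)
    then obtain y where y: "y \<in> I" "y / x \<notin> R"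
      using nonprincipal[OF x0] mem_scaled_iff[OF x0] by blast
    show ?thesis
    proof (cases "y / x \<in> V")
      case False
      then have "x / y \<in> M" "y \<noteq> 0"
        using inverse_outside[of "y / x"] subring_zero[OF subring] by auto
      then have "v * (x / y) \<in> R"
        using M_absorbs(1)[OF v] M_subset_R by blast
      then have "v * (x / y) * y \<in> I"
        using submodule_scale[OF sub _ y(1)] by blast
      then show ?thesis
        using \<open>y \<noteq> 0\<close> by simp
    next
      case True
      define J where "J = submodule_of_field R hull {x, y}"
      have J: "J \<in> nonzero_fractional_ideals R" "finitely_generated R J" "J \<subseteq> I"
        unfolding J_def using finitely_generated_subideal[OF I, of "{x, y}" x] x y x0 by simp_all
      have "(v * x) * w \<in> R" if w: "\<forall>z\<in>J. w * z \<in> R" for w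
      proof -
        have wx: "w * x \<in> R" and wy: "w * y \<in> R"
          using w by (auto simp: J_def hull_inc)
        have "w * x \<in> M"
        proof (rule ccontr)
          assume unit: "w * x \<notin> M"
          then have "w \<noteq> 0"
            using submodule_zero[OF submodule_V_M] by auto
          have "inverse (w * x) * (w * y) \<in> R"
            using inverse_R[OF wx unit] wy subring_mult[OF subring_R] by blast
          then show False
            using y(2) \<open>w \<noteq> 0\<close> by (simp add: field_simps)
        qed
        then have "v * (w * x) \<in> R"
          using M_absorbs(1)[OF v] M_subset_R by blast
        then show ?thesis
          by (simp add: ac_simps)
      qed
      then have "v * x \<in> v_closure R J"
        by (simp add: mem_v_closure_iff)
      then have "v * x \<in> t_closure R I"
        unfolding t_closure_def using J by blast
      then show ?thesis
        using t by simp
    qed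
  qed
  then show ?thesis
    using sub by (auto simp: submodule_of_field_def)
qed

lemma fractional_t_ideals_eq:
  "fractional_t_ideals R = {c *o R |c. c \<noteq> 0} \<union> nonzero_fractional_ideals V"
proof (intro equalityI subsetI)
  fix I assume I: "I \<in> fractional_t_ideals R"
  then have "submodule_of_field V I" if "\<And>c. c \<noteq> 0 \<Longrightarrow> I \<noteq> c *o R"
    using nonprincipal_t_ideal that by (simp add: fractional_t_ideals_def)
  then show "I \<in> {c *o R |c. c \<noteq> 0} \<union> nonzero_fractional_ideals V"
    using I by (auto simp: fractional_t_ideals_def nonzero_fractional_ideals_V
        nonzero_fractional_ideals_R)
next
  fix I assume "I \<in> {c *o R |c. c \<noteq> 0} \<union> nonzero_fractional_ideals V"
  then show "I \<in> fractional_t_ideals R"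
    unfolding fractional_t_ideals_def
    using t_closure_principal principal_nonzero_fractional
      t_closure_V_ideal nonzero_fractional_ideals_V_subset by auto
qed

section \<open>The class semigroups\<close>

lemma R_mult_submodule:
  assumes "submodule_of_field R I"
  shows "R * I = I"
proof
  show "R * I \<subseteq> I"
    using submodule_scale[OF assms] by (auto elim!: set_times_elim)
  show "I \<subseteq> R * I"
    using set_times_intro[OF subring_one[OF subring_R]] by fastforce
qed

lemma principal_mult_submodule:
  "submodule_of_field R I \<Longrightarrow> (c *o R) * I = c *o I"
  by (simp add: set_times_rearrange3 R_mult_submodule)

lemma scaled_V_ideal:
  assumes I: "I \<in> nonzero_fractional_ideals V" and c: "c \<noteq> 0"
  shows "c *o I \<in> nonzero_fractional_ideals V"
proof -
  obtain d where d: "d \<noteq> 0" "\<forall>x\<in>I. d * x \<in> R" and sub: "submodule_of_field V I"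
    using I by (auto simp: nonzero_fractional_ideals_V)
  obtain x where x: "x \<in> I" "x \<noteq> 0"
    using I nonzero_submoduleE unfolding nonzero_fractional_ideals_V by metis
  have "c * x \<in> c *o I" "c * x \<noteq> 0"
    using x c by auto
  moreover have "\<forall>y\<in>c *o I. d / c * y \<in> R"
    using d c by (auto simp: elt_set_times_def)
  ultimately show ?thesis
    unfolding nonzero_fractional_ideals_V using submodule_scaled[OF sub] d(1) c
    by (metis divide_eq_0_iff singletonD)
qed

lemma V_ideals_mult_closed:
  assumes I: "I \<in> nonzero_fractional_ideals V" and J: "J \<in> nonzero_fractional_ideals V"
  shows "I * J \<in> nonzero_fractional_ideals V"
proof -
  obtain d e where d: "d \<noteq> 0" "\<forall>x\<in>I. d * x \<in> R" and e: "e \<noteq> 0" "\<forall>x\<in>J. e * x \<in> R"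
    and sub: "submodule_of_field V I" "submodule_of_field V J"
    using I J by (auto simp: nonzero_fractional_ideals_V)
  obtain x y where "x \<in> I" "x \<noteq> 0" "y \<in> J" "y \<noteq> 0"
    using I J nonzero_submoduleE unfolding nonzero_fractional_ideals_V by metis
  then have "x * y \<in> I * J" "x * y \<noteq> 0"
    by auto
  moreover have "\<forall>z\<in>I * J. d * e * z \<in> R"
  proof
    fix z assume "z \<in> I * J"
    then obtain x y where z: "z = x * y" "x \<in> I" "y \<in> J"
      by (auto elim!: set_times_elim)
    then have "(d * x) * (e * y) \<in> R"
      using d e subring_mult[OF subring_R] by blast
    then show "d * e * z \<in> R"
      by (simp add: z ac_simps)
  qed
  ultimately show ?thesis
    unfolding nonzero_fractional_ideals_V using submodule_elementwise_product[OF sub] d(1) e(1)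
    by (metis mult_eq_0_iff singletonD)
qed

lemma ideal_mult_eq:
  "submodule_of_field S (I * J) \<Longrightarrow> ideal_mult S I J = I * J"
proof -
  have "{x * y |x y. x \<in> I \<and> y \<in> J} = I * J"
    by (auto simp: set_times_def)
  then show "submodule_of_field S (I * J) \<Longrightarrow> ideal_mult S I J = I * J"
    unfolding ideal_mult_def by (simp add: hull_same)
qed

lemma t_ideals_mult_closed:
  assumes I: "I \<in> fractional_t_ideals R" and J: "J \<in> fractional_t_ideals R"
  shows "I * J \<in> fractional_t_ideals R"
proof -
  have sub: "submodule_of_field R I" "submodule_of_field R J"
    using I J by (auto simp: fractional_t_ideals_def nonzero_fractional_ideals_R)
  have scaled: "c *o L \<in> fractional_t_ideals R" if "L \<in> fractional_t_ideals R" "c \<noteq> 0" for c L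
    using that scaled_V_ideal unfolding fractional_t_ideals_eq
    by (auto simp: set_times_rearrange2)
  show ?thesis
  proof (cases "I \<in> nonzero_fractional_ideals V \<and> J \<in> nonzero_fractional_ideals V")
    case True
    then show ?thesis
      using V_ideals_mult_closed unfolding fractional_t_ideals_eq by blast
  next
    case False
    then obtain c where "c \<noteq> 0" "I = c *o R \<or> J = c *o R"
      using I J unfolding fractional_t_ideals_eq by blast
    then show ?thesis
      using scaled I J principal_mult_submodule[OF sub(1), of c]
        principal_mult_submodule[OF sub(2), of c] by (auto simp: mult.commute)
  qed
qed

lemma elementwise_t_ideals: "elementwise_semigroup (fractional_t_ideals R) (t_mult R)"
proof
  fix I J assume IJ: "I \<in> fractional_t_ideals R" "J \<in> fractional_t_ideals R"
  show prod: "I * J \<in> fractional_t_ideals R"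
    using IJ by (rule t_ideals_mult_closed)
  then have "ideal_mult R I J = I * J"
    by (intro ideal_mult_eq) (simp add: fractional_t_ideals_def nonzero_fractional_ideals_R)
  then show "t_mult R I J = I * J"
    using prod by (simp add: t_mult_def fractional_t_ideals_def)
qed

lemma elementwise_V_ideals:
  "elementwise_semigroup (nonzero_fractional_ideals V) (ideal_mult V)"
proof
  fix I J assume IJ: "I \<in> nonzero_fractional_ideals V" "J \<in> nonzero_fractional_ideals V"
  then show "I * J \<in> nonzero_fractional_ideals V"
    by (rule V_ideals_mult_closed)
  then show "ideal_mult V I J = I * J"
    by (intro ideal_mult_eq) (simp add: nonzero_fractional_ideals_V)
qed

lemma V_ideal_regular:
  assumes I: "I \<in> nonzero_fractional_ideals V"
  obtains A where "A \<in> nonzero_fractional_ideals V" "I * I * A = I"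
proof -
  define A where "A = ideal_colon (ideal_colon I I) I"
  have sub: "submodule_of_field V I"
    using I by (simp add: nonzero_fractional_ideals_V)
  have reg: "I * I * A = I"
    unfolding A_def by (rule valuation_ideal_regular[OF sub])
  obtain x where x: "x \<in> I" "x \<noteq> 0"
    using I nonzero_submoduleE unfolding nonzero_fractional_ideals_V by metis
  obtain d where d: "d \<noteq> 0" "\<forall>x\<in>I. d * x \<in> R"
    using I by (auto simp: nonzero_fractional_ideals_V)
  have "A \<in> nonzero_fractional_ideals V"
    unfolding nonzero_fractional_ideals_V
  proof (intro conjI)
    show "submodule_of_field V A"
      unfolding A_def by (intro submodule_colon sub)
    show "A \<noteq> {0}"
    proof
      assume "A = {0}"
      then have "I * I * A \<subseteq> {0}"
        by (auto elim!: set_times_elim)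
      then show False
        using reg x by blast
    qed
    have "d * x * x * a \<in> R" if "a \<in> A" for a
    proof -
      have "a * x * x \<in> I"
        using that x(1) by (auto simp: A_def ideal_colon_def)
      then have "d * (a * x * x) \<in> R"
        using d(2) by blast
      then show ?thesis
        by (simp add: ac_simps)
    qed
    then show "\<exists>e. e \<noteq> 0 \<and> (\<forall>a\<in>A. e * a \<in> R)"
      using d(1) x(2) by (intro exI[of _ "d * x * x"]) auto
  qed
  then show thesis
    using that reg by blast
qed

lemma principal_square: "(c *o R) * (c *o R) = c *o (c *o R)"
  using principal_mult_submodule[OF submodule_scaled[OF submodule_self[OF subring_R]]] .

lemma clifford_t_regular_R: "clifford_t_regular R"
  unfolding clifford_t_regular_def
proof (rule elementwise_semigroup.cliffordI[OF elementwise_t_ideals])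
  fix I assume I: "I \<in> fractional_t_ideals R"
  consider c where "c \<noteq> 0" "I = c *o R" | "I \<in> nonzero_fractional_ideals V"
    using I unfolding fractional_t_ideals_eq by blast
  then show "\<exists>A\<in>fractional_t_ideals R. I * I * A = I"
  proof cases
    case 1
    have "c * c * inverse c = c"
      using 1(1) by simp
    then have "I * I * (inverse c *o R) = c *o R"
      using 1 R_mult_submodule[OF submodule_self[OF subring_R]]
      by (simp only: set_times_rearrange)
    moreover have "inverse c *o R \<in> fractional_t_ideals R"
      using 1(1) nonzero_imp_inverse_nonzero unfolding fractional_t_ideals_eq by blast
    ultimately show ?thesis
      using 1(2) by blast
  next
    case 2
    then obtain A where "A \<in> nonzero_fractional_ideals V" "I * I * A = I"
      by (rule V_ideal_regular)
    then show ?thesis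
      unfolding fractional_t_ideals_eq by (intro bexI[of _ A]) simp_all
  qed
qed

lemma boole_t_regular_R_iff: "boole_t_regular R \<longleftrightarrow> boole_regular V"
proof -
  define square_similar where
    "square_similar I \<longleftrightarrow> (\<exists>c. c \<noteq> 0 \<and> I * I = c *o I)" for I :: "'k set"
  have principal: "square_similar I" if "I \<in> {c *o R |c. c \<noteq> 0}" for I
  proof -
    obtain c where "c \<noteq> 0" "I = c *o R"
      using \<open>I \<in> {c *o R |c. c \<noteq> 0}\<close> by blast
    then have "c \<noteq> 0 \<and> I * I = c *o I"
      using principal_square[of c] by metis
    then show ?thesis
      unfolding square_similar_def by (rule exI)
  qed
  have "(\<forall>I\<in>fractional_t_ideals R. square_similar I) \<longleftrightarrow>
      (\<forall>I\<in>nonzero_fractional_ideals V. square_similar I)"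
    unfolding fractional_t_ideals_eq ball_Un using principal by blast
  then show ?thesis
    unfolding boole_t_regular_def boole_regular_def
      elementwise_semigroup.boolean_iff[OF elementwise_t_ideals]
      elementwise_semigroup.boolean_iff[OF elementwise_V_ideals]
    by (simp only: square_similar_def)
qed

section \<open>Locating the associated valuation overring\<close>

text \<open>
  For uniqueness: the maximal ideal of a valuation ring consists of its nonunits, and it
  determines the ring, as \<open>x \<noteq> 0\<close> lies outside the ring exactly when \<open>inverse x\<close> is a nonunit.
\<close>

lemma associated_valuation_overring_eq: "associated_valuation_overring R = V"
  unfolding associated_valuation_overring_def
proof (rule the_equality)
  show "valuation_overring R V \<and>
      (\<exists>N. {P. maximal_ideal_of R P} = {N} \<and> {P. maximal_ideal_of V P} = {N})"
    using subring R_subset_V total local_ring_maximal_ideals[OF local_R]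
      local_ring_maximal_ideals[OF local_V]
    by (auto simp: valuation_overring_def)
next
  fix W assume W: "valuation_overring R W \<and>
      (\<exists>N. {P. maximal_ideal_of R P} = {N} \<and> {P. maximal_ideal_of W P} = {N})"
  then interpret W: valuation_ring W
    by unfold_locales (auto simp: valuation_overring_def)
  have M: "W.nonunits = M"
    using W local_ring_maximal_ideals[OF local_R] local_ring_maximal_ideals[OF W.local_nonunits]
    by auto
  have "x \<in> W \<longleftrightarrow> x \<in> V" if "x \<noteq> 0" for x
  proof
    assume x: "x \<in> W"
    show "x \<in> V"
    proof (rule ccontr)
      assume "x \<notin> V"
      then have "inverse x \<in> W.nonunits"
        using inverse_outside M by simp
      then show False
        using x that by (auto simp: W.nonunits_def)
    qed
  next
    assume x: "x \<in> V"
    show "x \<in> W"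
    proof (rule ccontr)
      assume "x \<notin> W"
      then have "inverse x \<in> W.nonunits"
        using W.total[OF that] by (auto simp: W.nonunits_def)
      then have "x * inverse x \<in> M"
        using M_absorbs(1)[OF x] M by simp
      then show False
        using that one_notin_M by simp
    qed
  qed
  then show "W = V"
    using subring_zero[OF subring] subring_zero[OF W.subring] by (metis subsetI subset_antisym)
qed

end

text \<open>
  The defining property of a pseudo-valuation domain makes the maximal ideals comparable: if
  \<open>a \<in> M - N\<close> and \<open>b \<in> N - M\<close>, then \<open>(a / b) * b \<in> M\<close> puts \<open>a / b\<close> into \<open>M\<close>, and \<open>a = (a / b) * b \<in> N\<close>.
  It also says that \<open>x \<notin> M\<close> implies \<open>inverse x * M \<subseteq> M\<close>, so that \<open>(M : M)\<close> is the valuation ring.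
\<close>

lemma pseudo_valuation_domain_pair:
  assumes pvd: "pseudo_valuation_domain R"
  obtains M where "pvd_pair R (ideal_colon M M) M"
proof -
  have quotient: "domain_with_quotient_field R" and R: "subring_of_field R"
    using pvd by (auto simp: pseudo_valuation_domain_def domain_with_quotient_field_def)
  have ideal: "submodule_of_field R N" "N \<subseteq> R" "N \<noteq> R" if "maximal_ideal_of R N" for N
    using that by (auto simp: maximal_ideal_of_def ideal_of_def)
  have strongly_prime: "x \<in> N \<or> y \<in> N" if "maximal_ideal_of R N" "x * y \<in> N" for N x y
    using pvd maximal_ideal_is_prime[OF R that(1)] that(2)
    by (auto simp: pseudo_valuation_domain_def)
  have comparable: "N \<subseteq> M" if M: "maximal_ideal_of R M" and N: "maximal_ideal_of R N" for M N
  proof (rule ccontr)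
    assume "\<not> N \<subseteq> M"
    then obtain b where b: "b \<in> N" "b \<notin> M"
      by blast
    then have "b \<noteq> 0"
      using submodule_zero[OF ideal(1)[OF M]] by blast
    have "M \<subseteq> N"
    proof
      fix a assume "a \<in> M"
      then have "a / b * b \<in> M"
        using \<open>b \<noteq> 0\<close> by simp
      then have "a / b \<in> R"
        using strongly_prime[OF M] b(2) ideal(2)[OF M] by blast
      then have "a / b * b \<in> N"
        using submodule_scale[OF ideal(1)[OF N] _ b(1)] by blast
      then show "a \<in> N"
        using \<open>b \<noteq> 0\<close> by simp
    qed
    then show False
      using M N b unfolding maximal_ideal_of_def by blast
  qed
  have "ideal_of R {0}" "{0} \<noteq> R"
    using subring_zero[OF R] subring_one[OF R] by (auto simp: ideal_of_def submodule_of_field_def)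
  then obtain M where M: "maximal_ideal_of R M"
    using exists_maximal_ideal_containing[OF R] by metis
  note subM = ideal[OF M]
  have one: "1 \<notin> M"
    using subM ideal_containing_unit[of R M 1] subring_one[OF R] by (auto simp: ideal_of_def)
  have units: "inverse x \<in> R" if x: "x \<in> R" "x \<notin> M" for x
  proof (rule ccontr)
    assume no_inverse: "inverse x \<notin> R"
    have "x \<noteq> 0"
      using x(2) submodule_zero[OF subM(1)] by blast
    have "ideal_of R (x *o R)"
      using submodule_scaled[OF submodule_self[OF R]] subring_mult[OF R x(1)]
      by (auto simp: ideal_of_def elt_set_times_def)
    moreover have "1 \<notin> x *o R"
      using no_inverse \<open>x \<noteq> 0\<close> by (simp add: mem_scaled_iff inverse_eq_divide)
    ultimately obtain N where "maximal_ideal_of R N" "x *o R \<subseteq> N"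
      using exists_maximal_ideal_containing[OF R] subring_one[OF R] by metis
    moreover have "x \<in> x *o R"
      using subring_one[OF R] \<open>x \<noteq> 0\<close> by (simp add: mem_scaled_iff)
    ultimately show False
      using comparable[OF M] x(2) by blast
  qed
  have local_R: "local_ring_with R M"
    using R subM one units by (simp add: local_ring_with_def ideal_of_def)
  define V where "V = ideal_colon M M"
  have V: "x \<in> V \<longleftrightarrow> (\<forall>m\<in>M. x * m \<in> M)" for x
    by (auto simp: V_def ideal_colon_def)
  have RV: "R \<subseteq> V"
    using submodule_scale[OF subM(1)] by (auto simp: V)
  have inverse_V: "inverse x \<in> V" if "x \<notin> M" for x
    unfolding V
  proof
    fix m assume "m \<in> M"
    moreover have "x \<noteq> 0"
      using that submodule_zero[OF subM(1)] by blast
    ultimately have "x * (inverse x * m) \<in> M"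
      by (simp flip: mult.assoc)
    then show "inverse x * m \<in> M"
      using strongly_prime[OF M] that by blast
  qed
  have "subring_of_field V"
    unfolding subring_of_field_def
  proof (intro conjI ballI)
    show "1 \<in> V"
      by (simp add: V)
    have neg: "- 1 \<in> R"
      using R subring_zero[OF R] unfolding subring_of_field_def by (metis diff_0)
    fix x y assume "x \<in> V" "y \<in> V"
    then show "x * y \<in> V"
      by (auto simp: V mult.assoc)
    have "(x - y) * m \<in> M" if "m \<in> M" for m
    proof -
      have "(x - y) * m = x * m + (- 1) * (y * m)"
        by (simp add: algebra_simps)
      then show ?thesis
        using \<open>x \<in> V\<close> \<open>y \<in> V\<close> that neg submodule_add[OF subM(1)] submodule_scale[OF subM(1)]
        unfolding V by metis
    qed
    then show "x - y \<in> V"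
      by (simp add: V)
  qed
  moreover have "ideal_of V M"
    using subM(1,2) RV by (auto simp: ideal_of_def submodule_of_field_def V)
  ultimately have "local_ring_with V M"
    using one inverse_V by (simp add: local_ring_with_def)
  moreover have "inverse x \<in> M" if "x \<notin> V" for x
    using inverse_V[of "inverse x"] that by auto
  ultimately have "pvd_pair R V M"
    using quotient local_R RV by unfold_locales auto
  then show thesis
    using that V_def by blast
qed

theorem theorem2p7:
  fixes R :: "'k::field set"
  assumes "pseudo_valuation_domain R"
  shows "clifford_t_regular R \<and>
         (boole_t_regular R \<longleftrightarrow> boole_regular (associated_valuation_overring R))"
proof -
  obtain M where "pvd_pair R (ideal_colon M M) M"
    using assms by (rule pseudo_valuation_domain_pair)
  then interpret pvd_pair R "ideal_colon M M" M .
  show ?thesis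
    using clifford_t_regular_R boole_t_regular_R_iff associated_valuation_overring_eq by simp
qed

end
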